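(* Consider a 3D feature point observed in $n$ images (views). For $i=1,\dots,n$ let $R_i$ and $\boldsymbol t_i$ be the global rotation and global translation of the camera for view $i$, and let $X_i=(x_i,y_i,1)^T$ be the normalized image coordinate of the feature point in view $i$. Let views $\varsigma\neq\eta$ be the left- and right-base views. Then the following two descriptions of the imaging relationship are equivalent. (1) (Depth-pose-only (DPO) constraint set $D(\varsigma,\eta)$.) For every $i$ with $1\le i\le n$, $i\neq\varsigma$, $$d_i^{(\varsigma,i)}X_i=d_\varsigma^{(\varsigma,\eta)}R_{\varsigma,i}X_\varsigma+\boldsymbol t_{\varsigma,i}.$$ (2) (Projection equation.) There is a feature point $X^W=(x^W,y^W,z^W)^T$ such that, for every $i=1,\dots,n$, $$X_i=\frac{1}{z^{C_i}}X^{C_i}=\frac{1}{z^{C_i}}R_i(X^W-\boldsymbol t_i),$$ where $X^{C_i}=(x^{C_i},y^{C_i},z^{C_i})^T=R_i(X^W-\boldsymbol t_i)$ is the coordinate of the feature point in the camera frame of view $i$, and $z^{C_i}>0$ is its depth.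
   Context: $R_i\in SO(3)$ and $\boldsymbol t_i\in\mathbb R^3$. For $v\in\mathbb R^3$, $[v]_\times$ is the antisymmetric matrix with $[v]_\times w=v\times w$, and $\|\cdot\|$ is the Euclidean norm. For a pair of distinct views $(i,j)$, $$R_{i,j}=R_jR_i^T,\qquad \boldsymbol t_{i,j}=R_j(\boldsymbol t_i-\boldsymbol t_j),\qquad \theta_{i,j}=\|[X_j]_\times R_{i,j}X_i\|,$$ $$d_i^{(i,j)}=\frac{\|[X_j]_\times \boldsymbol t_{i,j}\|}{\theta_{i,j}},\qquad d_j^{(i,j)}=\frac{\|[R_{i,j}X_i]_\times \boldsymbol t_{i,j}\|}{\theta_{i,j}}.$$ The quantities $d_i^{(i,j)}$ and $d_j^{(i,j)}$ are the expressions, in terms of poses and image points only, of the depths $z^{C_i}$ and $z^{C_j}$ of the feature point in views $i$ and $j$. Standing assumption: the depths of the feature point in the views are positive. No condition on the values $\theta_{\varsigma,i}$ is part of the statement.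
   Formalization: Where θ_{ς,i}=0 the quotients for d are undefined (0/0, e.g. views with the same pose); there the depth in (1) is taken as some positive number, with one common unknown depth per view; positivity of the depths is made part of (1), as in the standing assumption. *)

theory Defs
  imports "HOL-Analysis.Analysis"
begin

definition cross_matrix :: "real^3 \<Rightarrow> real^3^3" where
  "cross_matrix v = matrix (cross3 v)"

lemma cross_matrix_vector_mult: "cross_matrix v *v w = cross3 v w"
  by (simp add: cross_matrix_def matrix_def matrix_vector_mult_def vec_eq_iff cross3_def forall_3
      sum_3 axis_def)

lemma transpose_cross_matrix: "transpose (cross_matrix v) = - cross_matrix v"
  by (simp add: cross_matrix_def matrix_def transpose_def vec_eq_iff cross3_def forall_3 axis_def)

definition rel_rot :: "(nat \<Rightarrow> real^3^3) \<Rightarrow> nat \<Rightarrow> nat \<Rightarrow> real^3^3" where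
  "rel_rot R i j = R j ** transpose (R i)"

definition rel_trans :: "(nat \<Rightarrow> real^3^3) \<Rightarrow> (nat \<Rightarrow> real^3) \<Rightarrow> nat \<Rightarrow> nat \<Rightarrow> real^3" where
  "rel_trans R t i j = R j *v (t i - t j)"

definition theta :: "(nat \<Rightarrow> real^3^3) \<Rightarrow> (nat \<Rightarrow> real^3) \<Rightarrow> nat \<Rightarrow> nat \<Rightarrow> real" where
  "theta R X i j = norm (cross_matrix (X j) *v (rel_rot R i j *v X i))"

text \<open>The expressions \<open>d\<^sub>i\<close> and \<open>d\<^sub>j\<close> of the pair \<open>(i, j)\<close> in terms of poses and image points.
  They are meaningful only if \<open>theta R X i j \<noteq> 0\<close>; in HOL they are \<open>0\<close> otherwise.\<close>

definition d_left ::
  "(nat \<Rightarrow> real^3^3) \<Rightarrow> (nat \<Rightarrow> real^3) \<Rightarrow> (nat \<Rightarrow> real^3) \<Rightarrow> nat \<Rightarrow> nat \<Rightarrow> real" where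
  "d_left R t X i j = norm (cross_matrix (X j) *v rel_trans R t i j) / theta R X i j"

definition d_right ::
  "(nat \<Rightarrow> real^3^3) \<Rightarrow> (nat \<Rightarrow> real^3) \<Rightarrow> (nat \<Rightarrow> real^3) \<Rightarrow> nat \<Rightarrow> nat \<Rightarrow> real" where
  "d_right R t X i j =
     norm (cross_matrix (rel_rot R i j *v X i) *v rel_trans R t i j) / theta R X i j"

text \<open>The depths of the feature point in the views \<open>i\<close> and \<open>j\<close>, as obtained from the pair
  \<open>(i, j)\<close>. If \<open>theta R X i j = 0\<close>, which for images of an actual feature point means coinciding
  camera centres or a feature point on the baseline, then the quotients have the indeterminate form
  \<open>0/0\<close>: the pair does not determine these depths, and they are read off a family \<open>z\<close> of
  depths instead. With HOL's
  \<open>x / 0 = 0\<close> the constraint of such a view would be a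
  wrong equation with depth \<open>0\<close>.\<close>

definition depth_left ::
  "(nat \<Rightarrow> real) \<Rightarrow> (nat \<Rightarrow> real^3^3) \<Rightarrow> (nat \<Rightarrow> real^3) \<Rightarrow> (nat \<Rightarrow> real^3) \<Rightarrow> nat \<Rightarrow> nat \<Rightarrow> real" where
  "depth_left z R t X i j = (if theta R X i j = 0 then z i else d_left R t X i j)"

definition depth_right ::
  "(nat \<Rightarrow> real) \<Rightarrow> (nat \<Rightarrow> real^3^3) \<Rightarrow> (nat \<Rightarrow> real^3) \<Rightarrow> (nat \<Rightarrow> real^3) \<Rightarrow> nat \<Rightarrow> nat \<Rightarrow> real" where
  "depth_right z R t X i j = (if theta R X i j = 0 then z j else d_right R t X i j)"

text \<open>The constraint set \<open>D(l, r)\<close> with left base view \<open>l\<close> and right base view \<open>r\<close>, together with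
  the standing assumption that the depths are positive. The family \<open>z\<close> matters only for pairs
  with vanishing \<open>theta\<close>; see \<open>dpo_constraints_regular\<close>.\<close>

definition dpo_constraints ::
  "nat \<Rightarrow> (nat \<Rightarrow> real^3^3) \<Rightarrow> (nat \<Rightarrow> real^3) \<Rightarrow> (nat \<Rightarrow> real^3) \<Rightarrow> nat \<Rightarrow> nat \<Rightarrow> bool" where
  "dpo_constraints n R t X l r \<longleftrightarrow>
     (\<exists>z. depth_left z R t X l r > 0 \<and>
        (\<forall>i\<in>{1..n} - {l}.
           depth_right z R t X l i > 0 \<and>
           depth_right z R t X l i *\<^sub>R X i =
             depth_left z R t X l r *\<^sub>R (rel_rot R l i *v X l) + rel_trans R t l i))"

lemma dpo_constraints_regular:
  assumes "r \<in> {1..n} - {l}" and "\<And>i. i \<in> {1..n} - {l} \<Longrightarrow> theta R X l i \<noteq> 0"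
  shows "dpo_constraints n R t X l r \<longleftrightarrow>
    d_left R t X l r > 0 \<and> (\<forall>i\<in>{1..n} - {l}. d_right R t X l i > 0) \<and>
    (\<forall>i\<in>{1..n} - {l}.
       d_right R t X l i *\<^sub>R X i =
         d_left R t X l r *\<^sub>R (rel_rot R l i *v X l) + rel_trans R t l i)"
  using assms unfolding dpo_constraints_def depth_left_def depth_right_def by auto

definition camera_coords ::
  "(nat \<Rightarrow> real^3^3) \<Rightarrow> (nat \<Rightarrow> real^3) \<Rightarrow> real^3 \<Rightarrow> nat \<Rightarrow> real^3" where
  "camera_coords R t XW i = R i *v (XW - t i)"

definition projection_equation ::
  "nat \<Rightarrow> (nat \<Rightarrow> real^3^3) \<Rightarrow> (nat \<Rightarrow> real^3) \<Rightarrow> (nat \<Rightarrow> real^3) \<Rightarrow> bool" where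
  "projection_equation n R t X \<longleftrightarrow>
     (\<exists>XW. \<forall>i\<in>{1..n}.
        camera_coords R t XW i $ 3 > 0 \<and>
        X i = (1 / camera_coords R t XW i $ 3) *\<^sub>R camera_coords R t XW i)"

end

(* All camera frames are related by X^{C_i} = R_{l,i} X^{C_l} + t_{l,i}, and the projection equation
   says X^{C_i} = z_i X_i with z_i > 0.  Crossing z_i X_i = z_l R_{l,i} X_l + t_{l,i} with X_i,
   respectively with R_{l,i} X_l, eliminates one of the two depths, and taking norms gives the
   quotients defining d_l and d_i.  Conversely, back-projecting d_l X_l from view l yields the
   feature point. *)
theory Submission
  imports Defs
begin

lemma camera_coords_change_view:
  assumes "orthogonal_matrix (R l)"
  shows "camera_coords R t XW i = rel_rot R l i *v camera_coords R t XW l + rel_trans R t l i"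
proof -
  have "rel_rot R l i *v camera_coords R t XW l = (R i ** (transpose (R l) ** R l)) *v (XW - t l)"
    by (simp add: rel_rot_def camera_coords_def matrix_vector_mul_assoc matrix_mul_assoc)
  also have "\<dots> = R i *v (XW - t l)"
    using assms by (simp add: orthogonal_matrix_def)
  finally show ?thesis
    by (simp add: camera_coords_def rel_trans_def matrix_vector_right_distrib[symmetric])
qed

text \<open>Back-projection: this world point is the one seen from view \<open>l\<close> at a
  prescribed position \<open>v\<close>. It supplies the feature point once a depth along the ray of
  \<open>X l\<close> is known.\<close>

lemma camera_coords_back_projection:
  assumes "orthogonal_matrix (R l)"
  shows "camera_coords R t (t l + transpose (R l) *v v) l = v"
  using assms by (simp add: camera_coords_def orthogonal_matrix_def matrix_vector_mul_assoc
      del: transpose_matrix_vector)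

text \<open>With \<open>w = a *\<^sub>R u - b *\<^sub>R v\<close>, crossing with \<open>u\<close>
  kills the first term and crossing with \<open>v\<close> the second. No division occurs, so
  parallel \<open>u\<close> and \<open>v\<close> are covered too.\<close>

lemma norm_cross3_relation:
  assumes "a *\<^sub>R u = b *\<^sub>R v + w"
  shows "norm (cross3 u w) = \<bar>b\<bar> * norm (cross3 u v)"
    and "norm (cross3 v w) = \<bar>a\<bar> * norm (cross3 u v)"
proof -
  have w: "w = a *\<^sub>R u - b *\<^sub>R v"
    using assms by simp
  show "norm (cross3 u w) = \<bar>b\<bar> * norm (cross3 u v)"
    by (simp add: w Cross3.right_diff_distrib cross_mult_right)
  show "norm (cross3 v w) = \<bar>a\<bar> * norm (cross3 u v)"
    by (simp add: w Cross3.right_diff_distrib cross_mult_right cross_skew[of v u])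
qed

text \<open>If \<open>theta\<close> vanishes, both depths are read off \<open>z\<close> by
  definition. Otherwise the norm relations are divided by \<open>theta\<close>, and positivity
  removes the absolute values.\<close>

lemma depths_eq:
  assumes "z i *\<^sub>R X i = z l *\<^sub>R (rel_rot R l i *v X l) + rel_trans R t l i"
    and "z l > 0" and "z i > 0"
  shows "depth_left z R t X l i = z l" and "depth_right z R t X l i = z i"
  using norm_cross3_relation[OF assms(1)] assms(2,3)
  by (auto simp: depth_left_def depth_right_def d_left_def d_right_def theta_def
      cross_matrix_vector_mult)

theorem proposition3:
  fixes n l r :: nat
    and R :: "nat \<Rightarrow> real^3^3"
    and t X :: "nat \<Rightarrow> real^3"
    and x y :: "nat \<Rightarrow> real"
  assumes "\<And>i. i \<in> {1..n} \<Longrightarrow> rotation_matrix (R i)"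
    and "\<And>i. i \<in> {1..n} \<Longrightarrow> X i = vector [x i, y i, 1]"
    and "l \<in> {1..n}" and "r \<in> {1..n}" and "l \<noteq> r"
  shows "dpo_constraints n R t X l r \<longleftrightarrow> projection_equation n R t X"
proof -
  have orth: "orthogonal_matrix (R l)"
    using assms(1,3) by (simp add: rotation_matrix_def)
  have X3: "X i $ 3 = 1" if "i \<in> {1..n}" for i
    using assms(2)[OF that] by simp
  have proj: "projection_equation n R t X \<longleftrightarrow>
    (\<exists>XW. \<forall>i\<in>{1..n}. camera_coords R t XW i $ 3 > 0 \<and>
       camera_coords R t XW i = (camera_coords R t XW i $ 3) *\<^sub>R X i)"
  proof -
    \<comment> \<open>Positivity stays on both sides, so that clearing the denominator is
      reversible.\<close>
    have "c $ 3 > 0 \<and> u = (1 / c $ 3) *\<^sub>R c \<longleftrightarrow> c $ 3 > 0 \<and> c = (c $ 3) *\<^sub>R u"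
      for c u :: "real^3"
      by (auto simp: eq_vector_fraction_iff)
    then show ?thesis
      unfolding projection_equation_def by (simp only:)
  qed
  show ?thesis
  proof
    assume "dpo_constraints n R t X l r"
    then obtain z where zl: "depth_left z R t X l r > 0"
      and zi: "\<And>i. i \<in> {1..n} - {l} \<Longrightarrow> depth_right z R t X l i > 0 \<and>
           depth_right z R t X l i *\<^sub>R X i =
             depth_left z R t X l r *\<^sub>R (rel_rot R l i *v X l) + rel_trans R t l i"
      unfolding dpo_constraints_def by blast
    define XW where "XW = t l + transpose (R l) *v (depth_left z R t X l r *\<^sub>R X l)"
    have cl: "camera_coords R t XW l = depth_left z R t X l r *\<^sub>R X l"
      unfolding XW_def by (rule camera_coords_back_projection[of R l, OF orth])
    \<comment> \<open>Some positive factor suffices here: as \<open>X i $ 3 = 1\<close>, it must be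
      the third camera coordinate.\<close>
    have ex: "\<exists>d>0. camera_coords R t XW i = d *\<^sub>R X i" if "i \<in> {1..n}" for i
    proof (cases "i = l")
      case True
      with cl zl show ?thesis by blast
    next
      case False
      then have "camera_coords R t XW i = depth_right z R t X l i *\<^sub>R X i"
        using zi[of i] that
        by (simp add: camera_coords_change_view[of R l t XW i, OF orth] cl matrix_vector_mult_scaleR)
      with False zi[of i] that show ?thesis by blast
    qed
    have "camera_coords R t XW i $ 3 > 0 \<and>
        camera_coords R t XW i = (camera_coords R t XW i $ 3) *\<^sub>R X i" if "i \<in> {1..n}" for i
      using ex[OF that] X3[OF that] by auto
    then show "projection_equation n R t X"
      unfolding proj by blast
  next
    assume "projection_equation n R t X"
    then obtain XW where XW: "\<And>i. i \<in> {1..n} \<Longrightarrow> camera_coords R t XW i $ 3 > 0 \<and>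
       camera_coords R t XW i = (camera_coords R t XW i $ 3) *\<^sub>R X i"
      unfolding proj by blast
    \<comment> \<open>The true depths serve as the family for pairs with vanishing
      \<open>theta\<close>.\<close>
    define z where "z i = camera_coords R t XW i $ 3" for i
    have pos: "z i > 0" and cam: "camera_coords R t XW i = z i *\<^sub>R X i" if "i \<in> {1..n}" for i
      using XW[OF that] by (simp_all add: z_def)
    have rel: "z i *\<^sub>R X i = z l *\<^sub>R (rel_rot R l i *v X l) + rel_trans R t l i"
      if "i \<in> {1..n}" for i
      using camera_coords_change_view[of R l t XW i, OF orth] cam[OF that] cam[OF assms(3)]
      by (simp add: matrix_vector_mult_scaleR)
    \<comment> \<open>The left depth is the same for every partner view, so the value obtained from
      the pair \<open>(l, r)\<close> fits the constraint of each view \<open>i\<close>.\<close>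
    have "depth_left z R t X l i = z l" "depth_right z R t X l i = z i" if "i \<in> {1..n}" for i
      using depths_eq[of z i X l R t, OF rel[OF that] pos[OF assms(3)] pos[OF that]] by simp_all
    then show "dpo_constraints n R t X l r"
      unfolding dpo_constraints_def using pos rel assms(3,4) by (intro exI[of _ z]) auto
  qed
qed

end
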